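(* The category of strict $\tilde{\mathbb H}$-algebras and lax homomorphisms is the category $\mathcal V\text{-}\mathsf{Mod}$ itself; that is, every $\mathcal V$-category $X$ carries exactly one strict $\tilde{\mathbb H}$-algebra structure, and every $\mathcal V$-module $\varphi:X\to Y$ is a lax homomorphism with respect to the uniquely determined structures on $X$ and $Y$.
   Context: $\mathcal V$ is a commutative unital quantale: a complete lattice with a commutative, associative operation $\otimes$ with neutral element $k$, such that $\otimes$ preserves arbitrary suprema in each variable; it is assumed that $k>\bot$. A $\mathcal V$-category $X=(X,a)$ is a set $X$ with $a:X\times X\to\mathcal V$ satisfying $k\le a(x,x)$ and $a(x,y)\otimes a(y,z)\le a(x,z)$; one writes $1_X^*:=a$. A $\mathcal V$-module $\varphi:X\to Y$ between $(X,a)$ and $(Y,b)$ is a function $\varphi:X\times Y\to\mathcal V$ with $a(x',x)\otimes\varphi(x,y)\le\varphi(x',y)$ and $\varphi(x,y)\otimes b(y,y')\le\varphi(x,y')$; composition is $(\psi\cdot\varphi)(x,z)=\bigvee_{y}\varphi(x,y)\otimes\psi(y,z)$, with identities $1_X^*$; hom-sets of the category $\mathcal V\text{-}\mathsf{Mod}$ are ordered pointwise. For a $\mathcal V$-category $X$, $HX=(PX,h_X)$ with $PX$ the powerset of $X$ and $h_X(A,B)=\bigwedge_{x\in A}\bigvee_{y\in B}a(x,y)$. The lax monad $\tilde{\mathbb H}=(\tilde H,\delta,\nu)$ on $\mathcal V\text{-}\mathsf{Mod}$ has $\tilde HX=HX$; for $\varphi:X\to Y$, $\tilde H\varphi(A,B)=\bigwedge_{x\in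 A}\bigvee_{y\in B}\varphi(x,y)$; $\delta_X:X\to HX$, $\delta_X(x,B)=h_X(\{x\},B)$; $\nu_X:HHX\to HX$, $\nu_X(\mathcal A,B)=h_X(\bigcup\mathcal A,B)$. A strict $\tilde{\mathbb H}$-algebra is a $\mathcal V$-category $X$ with a $\mathcal V$-module $\alpha:HX\to X$ such that $\alpha\cdot\delta_X=1_X^*$ and $\alpha\cdot\nu_X=\alpha\cdot\tilde H\alpha$. A lax homomorphism $(X,\alpha)\to(Y,\beta)$ is a $\mathcal V$-module $\varphi:X\to Y$ with $\varphi\cdot\alpha\le\beta\cdot\tilde H\varphi$. *)

theory Defs
  imports Main "HOL-Library.FuncSet"
begin

text \<open>
  The tensor of the quantale is \<open>(*)\<close> and its neutral element is \<open>1\<close>. Preservation of suprema in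
  the first variable follows by commutativity.
\<close>

class comm_unital_quantale = complete_lattice + comm_monoid_mult +
  assumes mult_Sup: "x * Sup B = (SUP y\<in>B. x * y)"
    and bot_less_one: "bot < 1"

text \<open>
  Sets are carrier subsets of a type, so the empty \<open>\<V>\<close>-category is included. Functions
  \<open>X \<times> Y \<rightarrow> \<V>\<close> are extensional (\<open>\<rightarrow>\<^sub>E\<close>), hence HOL equality and the pointwise order of HOL
  functions coincide with equality and pointwise order on \<open>X \<times> Y\<close>.
\<close>

record ('a, 'v) vcat =
  pts :: "'a set"
  str :: "'a \<times> 'a \<Rightarrow> 'v"

definition is_vcat :: "('a, 'v::comm_unital_quantale) vcat \<Rightarrow> bool" where
  "is_vcat X \<longleftrightarrow>
     str X \<in> pts X \<times> pts X \<rightarrow>\<^sub>E UNIV \<and>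
     (\<forall>x\<in>pts X. 1 \<le> str X (x, x)) \<and>
     (\<forall>x\<in>pts X. \<forall>y\<in>pts X. \<forall>z\<in>pts X. str X (x, y) * str X (y, z) \<le> str X (x, z))"

definition vmodule ::
  "('a, 'v::comm_unital_quantale) vcat \<Rightarrow> ('b, 'v) vcat \<Rightarrow> ('a \<times> 'b \<Rightarrow> 'v) \<Rightarrow> bool" where
  "vmodule X Y \<phi> \<longleftrightarrow>
     is_vcat X \<and> is_vcat Y \<and>
     \<phi> \<in> pts X \<times> pts Y \<rightarrow>\<^sub>E UNIV \<and>
     (\<forall>x'\<in>pts X. \<forall>x\<in>pts X. \<forall>y\<in>pts Y. str X (x', x) * \<phi> (x, y) \<le> \<phi> (x', y)) \<and>
     (\<forall>x\<in>pts X. \<forall>y\<in>pts Y. \<forall>y'\<in>pts Y. \<phi> (x, y) * str Y (y, y') \<le> \<phi> (x, y'))"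

text \<open>\<open>mcomp X Y Z \<psi> \<phi>\<close> is \<open>\<psi> \<cdot> \<phi>\<close> for \<open>\<phi> : X \<rightarrow> Y\<close> and \<open>\<psi> : Y \<rightarrow> Z\<close>.\<close>

definition mcomp ::
  "('a, 'v::comm_unital_quantale) vcat \<Rightarrow> ('b, 'v) vcat \<Rightarrow> ('c, 'v) vcat \<Rightarrow>
   ('b \<times> 'c \<Rightarrow> 'v) \<Rightarrow> ('a \<times> 'b \<Rightarrow> 'v) \<Rightarrow> ('a \<times> 'c \<Rightarrow> 'v)" where
  "mcomp X Y Z \<psi> \<phi> =
     restrict (\<lambda>(x, z). SUP y\<in>pts Y. \<phi> (x, y) * \<psi> (y, z)) (pts X \<times> pts Z)"

definition Hmod ::
  "('a, 'v::comm_unital_quantale) vcat \<Rightarrow> ('b, 'v) vcat \<Rightarrow> ('a \<times> 'b \<Rightarrow> 'v) \<Rightarrow>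
   ('a set \<times> 'b set \<Rightarrow> 'v)" where
  "Hmod X Y \<phi> =
     restrict (\<lambda>(A, B). INF x\<in>A. SUP y\<in>B. \<phi> (x, y)) (Pow (pts X) \<times> Pow (pts Y))"

definition Hcat :: "('a, 'v::comm_unital_quantale) vcat \<Rightarrow> ('a set, 'v) vcat" where
  "Hcat X = \<lparr>pts = Pow (pts X),
             str = restrict (\<lambda>(A, B). INF x\<in>A. SUP y\<in>B. str X (x, y))
                     (Pow (pts X) \<times> Pow (pts X))\<rparr>"

definition unitH :: "('a, 'v::comm_unital_quantale) vcat \<Rightarrow> ('a \<times> 'a set \<Rightarrow> 'v)" where
  "unitH X = restrict (\<lambda>(x, B). str (Hcat X) ({x}, B)) (pts X \<times> pts (Hcat X))"

definition multH :: "('a, 'v::comm_unital_quantale) vcat \<Rightarrow> ('a set set \<times> 'a set \<Rightarrow> 'v)" where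
  "multH X = restrict (\<lambda>(\<A>, B). str (Hcat X) (\<Union>\<A>, B)) (pts (Hcat (Hcat X)) \<times> pts (Hcat X))"

definition strict_alg ::
  "('a, 'v::comm_unital_quantale) vcat \<Rightarrow> ('a set \<times> 'a \<Rightarrow> 'v) \<Rightarrow> bool" where
  "strict_alg X \<alpha> \<longleftrightarrow>
     is_vcat X \<and> vmodule (Hcat X) X \<alpha> \<and>
     mcomp X (Hcat X) X \<alpha> (unitH X) = str X \<and>
     mcomp (Hcat (Hcat X)) (Hcat X) X \<alpha> (multH X) =
       mcomp (Hcat (Hcat X)) (Hcat X) X \<alpha> (Hmod (Hcat X) X \<alpha>)"

definition lax_hom ::
  "('a, 'v::comm_unital_quantale) vcat \<Rightarrow> ('a set \<times> 'a \<Rightarrow> 'v) \<Rightarrow>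
   ('b, 'v) vcat \<Rightarrow> ('b set \<times> 'b \<Rightarrow> 'v) \<Rightarrow> ('a \<times> 'b \<Rightarrow> 'v) \<Rightarrow> bool" where
  "lax_hom X \<alpha> Y \<beta> \<phi> \<longleftrightarrow>
     vmodule X Y \<phi> \<and>
     mcomp (Hcat X) X Y \<phi> \<alpha> \<le> mcomp (Hcat X) (Hcat Y) Y \<beta> (Hmod X Y \<phi>)"

text \<open>\<open>Comp C x y z g f\<close> is the composite of \<open>f : x \<rightarrow> y\<close> and \<open>g : y \<rightarrow> z\<close>.\<close>

record ('o, 'm) cat_data =
  Obj :: "'o set"
  Hom :: "'o \<Rightarrow> 'o \<Rightarrow> 'm set"
  Ident :: "'o \<Rightarrow> 'm"
  Comp :: "'o \<Rightarrow> 'o \<Rightarrow> 'o \<Rightarrow> 'm \<Rightarrow> 'm \<Rightarrow> 'm"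

locale category =
  fixes C :: "('o, 'm) cat_data"
  assumes ident_hom: "x \<in> Obj C \<Longrightarrow> Ident C x \<in> Hom C x x"
    and comp_hom: "\<lbrakk>x \<in> Obj C; y \<in> Obj C; z \<in> Obj C; f \<in> Hom C x y; g \<in> Hom C y z\<rbrakk>
      \<Longrightarrow> Comp C x y z g f \<in> Hom C x z"
    and comp_ident_right: "\<lbrakk>x \<in> Obj C; y \<in> Obj C; f \<in> Hom C x y\<rbrakk>
      \<Longrightarrow> Comp C x x y f (Ident C x) = f"
    and comp_ident_left: "\<lbrakk>x \<in> Obj C; y \<in> Obj C; f \<in> Hom C x y\<rbrakk>
      \<Longrightarrow> Comp C x y y (Ident C y) f = f"
    and comp_assoc: "\<lbrakk>w \<in> Obj C; x \<in> Obj C; y \<in> Obj C; z \<in> Obj C;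
        f \<in> Hom C w x; g \<in> Hom C x y; h \<in> Hom C y z\<rbrakk>
      \<Longrightarrow> Comp C w y z h (Comp C w x y g f) = Comp C w x z (Comp C x y z h g) f"

locale category_isomorphism = C: category C + D: category D
  for C :: "('o, 'm) cat_data" and D :: "('p, 'n) cat_data" +
  fixes F_obj :: "'o \<Rightarrow> 'p" and F_mor :: "'o \<Rightarrow> 'o \<Rightarrow> 'm \<Rightarrow> 'n"
  assumes bij_obj: "bij_betw F_obj (Obj C) (Obj D)"
    and bij_hom: "\<lbrakk>x \<in> Obj C; y \<in> Obj C\<rbrakk>
      \<Longrightarrow> bij_betw (F_mor x y) (Hom C x y) (Hom D (F_obj x) (F_obj y))"
    and preserves_ident: "x \<in> Obj C \<Longrightarrow> F_mor x x (Ident C x) = Ident D (F_obj x)"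
    and preserves_comp: "\<lbrakk>x \<in> Obj C; y \<in> Obj C; z \<in> Obj C; f \<in> Hom C x y; g \<in> Hom C y z\<rbrakk>
      \<Longrightarrow> F_mor x z (Comp C x y z g f) =
        Comp D (F_obj x) (F_obj y) (F_obj z) (F_mor y z g) (F_mor x y f)"

definition VMod :: "(('a, 'v::comm_unital_quantale) vcat, 'a \<times> 'a \<Rightarrow> 'v) cat_data" where
  "VMod = \<lparr>Obj = {X. is_vcat X},
           Hom = (\<lambda>X Y. {\<phi>. vmodule X Y \<phi>}),
           Ident = str,
           Comp = mcomp\<rparr>"

definition StrictAlg ::
  "(('a, 'v::comm_unital_quantale) vcat \<times> ('a set \<times> 'a \<Rightarrow> 'v), 'a \<times> 'a \<Rightarrow> 'v) cat_data" where
  "StrictAlg = \<lparr>Obj = {(X, \<alpha>). strict_alg X \<alpha>},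
                Hom = (\<lambda>(X, \<alpha>) (Y, \<beta>). {\<phi>. lax_hom X \<alpha> Y \<beta> \<phi>}),
                Ident = (\<lambda>(X, \<alpha>). str X),
                Comp = (\<lambda>(X, \<alpha>) (Y, \<beta>) (Z, \<gamma>). mcomp X Y Z)\<rparr>"

end

theory Submission
  imports Defs
begin

text \<open>
  The unique strict algebra structure on \<open>X\<close> is \<open>\<alpha>(A, y) = h\<^sub>X(A, {y})\<close>, the greatest lower bound
  of the values \<open>a(x, y)\<close> with \<open>x \<in> A\<close>. Since \<open>\<delta>\<^sub>X\<close> and \<open>\<nu>\<^sub>X\<close> are \<open>h\<^sub>X\<close> restricted along
  \<open>x \<mapsto> {x}\<close> and \<open>\<A> \<mapsto> \<Union>\<A>\<close>, the identity law of \<open>h\<^sub>X\<close> gives \<open>(\<alpha> \<cdot> \<delta>\<^sub>X)(x, y) = \<alpha>({x}, y)\<close> and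
  \<open>(\<alpha> \<cdot> \<nu>\<^sub>X)(\<A>, y) = \<alpha>(\<Union>\<A>, y)\<close>. The first value is \<open>a(x, y)\<close>; the second agrees with
  \<open>(\<alpha> \<cdot> H\<alpha>)(\<A>, y)\<close>, where the supremum over \<open>B\<close> in the composite is reached at \<open>B = {y}\<close>.

  Uniqueness needs only the unit law. It says \<open>\<alpha>({x}, y) = a(x, y)\<close>, in particular
  \<open>k \<le> \<alpha>({y}, y)\<close>, whence \<open>h\<^sub>X(A, {y}) \<le> h\<^sub>X(A, {y}) \<otimes> \<alpha>({y}, y) \<le> \<alpha>(A, y)\<close>. Conversely, for
  \<open>x \<in> A\<close> one has \<open>k \<le> h\<^sub>X({x}, A)\<close>, so \<open>\<alpha>(A, y) \<le> h\<^sub>X({x}, A) \<otimes> \<alpha>(A, y) \<le> \<alpha>({x}, y) = a(x, y)\<close>.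

  For a module \<open>\<phi> : X \<rightarrow> Y\<close>, both sides of the lax homomorphism inequality are compared with
  \<open>H\<phi>(A, {y})\<close>, which bounds the left side from above and the right side from below. The lax
  homomorphisms are therefore all modules, so the category laws for strict algebras are those of
  modules, and forgetting the structure is an isomorphism of categories.
\<close>

section \<open>Inequalities in a quantale\<close>

lemma quantale_mult_right_mono:
  fixes x y z :: "'v::comm_unital_quantale"
  assumes "y \<le> z"
  shows "x * y \<le> x * z"
proof -
  have "x * z = x * Sup {y, z}"
    using assms by (simp add: sup_absorb2)
  also have "\<dots> = sup (x * y) (x * z)"
    by (subst mult_Sup) simp
  finally show ?thesis
    by (metis sup_ge1)
qed

lemma quantale_mult_mono:
  fixes x y z w :: "'v::comm_unital_quantale"
  assumes "x \<le> y" and "z \<le> w"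
  shows "x * z \<le> y * w"
proof -
  have "x * z \<le> x * w"
    by (rule quantale_mult_right_mono) fact
  also have "\<dots> \<le> y * w"
    using quantale_mult_right_mono[OF assms(1), of w] by (simp add: mult.commute)
  finally show ?thesis .
qed

lemma le_mult_right:
  fixes x y :: "'v::comm_unital_quantale"
  assumes "1 \<le> y"
  shows "x \<le> x * y"
  using quantale_mult_right_mono[OF assms, of x] by simp

lemma le_mult_left:
  fixes x y :: "'v::comm_unital_quantale"
  assumes "1 \<le> y"
  shows "x \<le> y * x"
  using le_mult_right[OF assms, of x] by (simp add: mult.commute)

lemma mult_SUP:
  fixes x :: "'v::comm_unital_quantale"
  shows "x * (SUP i\<in>I. f i) = (SUP i\<in>I. x * f i)"
  by (simp add: mult_Sup image_image)

lemma SUP_mult: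
  fixes x :: "'v::comm_unital_quantale"
  shows "(SUP i\<in>I. f i) * x = (SUP i\<in>I. f i * x)"
  using mult_SUP[of x f I] by (simp add: mult.commute)

text \<open>
  If \<open>f x y \<otimes> g y z \<le> e x z\<close> throughout, the Hausdorff liftings satisfy the same inequality. The
  triangle inequality for \<open>h\<^sub>X\<close> is an instance; singletons for \<open>B\<close> or \<open>C\<close> give the upper bounds in
  the associativity law and in the lax homomorphism inequality.
\<close>

lemma INF_SUP_mult_le:
  fixes f :: "'a \<Rightarrow> 'b \<Rightarrow> 'v::comm_unital_quantale"
  assumes "\<And>x y z. \<lbrakk>x \<in> A; y \<in> B; z \<in> C\<rbrakk> \<Longrightarrow> f x y * g y z \<le> e x z"
  shows "(INF x\<in>A. SUP y\<in>B. f x y) * (INF y\<in>B. SUP z\<in>C. g y z) \<le> (INF x\<in>A. SUP z\<in>C. e x z)"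
    (is "?F * ?G \<le> _")
proof (rule INF_greatest)
  fix x assume x: "x \<in> A"
  have "?F * ?G \<le> (SUP y\<in>B. f x y) * ?G"
    by (intro quantale_mult_mono INF_lower x order_refl)
  also have "\<dots> = (SUP y\<in>B. f x y * ?G)"
    by (rule SUP_mult)
  also have "\<dots> \<le> (SUP z\<in>C. e x z)"
  proof (rule SUP_least)
    fix y assume y: "y \<in> B"
    have "f x y * ?G \<le> f x y * (SUP z\<in>C. g y z)"
      by (intro quantale_mult_right_mono INF_lower y)
    also have "\<dots> = (SUP z\<in>C. f x y * g y z)"
      by (rule mult_SUP)
    also have "\<dots> \<le> (SUP z\<in>C. e x z)"
      by (intro SUP_subset_mono order_refl assms x y)
    finally show "f x y * ?G \<le> (SUP z\<in>C. e x z)" .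
  qed
  finally show "?F * ?G \<le> (SUP z\<in>C. e x z)" .
qed

section \<open>The category of modules\<close>

lemma vcat_refl: "is_vcat X \<Longrightarrow> x \<in> pts X \<Longrightarrow> 1 \<le> str X (x, x)"
  by (simp add: is_vcat_def)

lemma vcat_trans:
  "\<lbrakk>is_vcat X; x \<in> pts X; y \<in> pts X; z \<in> pts X\<rbrakk>
    \<Longrightarrow> str X (x, y) * str X (y, z) \<le> str X (x, z)"
  by (simp add: is_vcat_def)

lemma vmodule_left:
  "\<lbrakk>vmodule X Y \<phi>; x' \<in> pts X; x \<in> pts X; y \<in> pts Y\<rbrakk>
    \<Longrightarrow> str X (x', x) * \<phi> (x, y) \<le> \<phi> (x', y)"
  by (simp add: vmodule_def)

lemma vmodule_right:
  "\<lbrakk>vmodule X Y \<phi>; x \<in> pts X; y \<in> pts Y; y' \<in> pts Y\<rbrakk>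
    \<Longrightarrow> \<phi> (x, y) * str Y (y, y') \<le> \<phi> (x, y')"
  by (simp add: vmodule_def)

lemma vmodule_vcat:
  assumes "vmodule X Y \<phi>"
  shows "is_vcat X" and "is_vcat Y"
  using assms by (simp_all add: vmodule_def)

lemma vmodule_ext: "vmodule X Y \<phi> \<Longrightarrow> \<phi> \<in> pts X \<times> pts Y \<rightarrow>\<^sub>E UNIV"
  by (simp add: vmodule_def)

lemma mcomp_ext: "mcomp X Y Z \<psi> \<phi> \<in> pts X \<times> pts Z \<rightarrow>\<^sub>E UNIV"
  by (simp add: mcomp_def PiE_iff)

lemma mcomp_apply:
  "x \<in> pts X \<Longrightarrow> z \<in> pts Z \<Longrightarrow> mcomp X Y Z \<psi> \<phi> (x, z) = (SUP y\<in>pts Y. \<phi> (x, y) * \<psi> (y, z))"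
  by (simp add: mcomp_def)

lemma extensional_eqI:
  assumes "f \<in> A \<times> B \<rightarrow>\<^sub>E UNIV" and "g \<in> A \<times> B \<rightarrow>\<^sub>E UNIV"
    and "\<And>x y. \<lbrakk>x \<in> A; y \<in> B\<rbrakk> \<Longrightarrow> f (x, y) = g (x, y)"
  shows "f = g"
  using assms by (intro PiE_ext[of f "A \<times> B" "\<lambda>_. UNIV" g]) auto

lemma vmodule_str: "is_vcat X \<Longrightarrow> vmodule X X (str X)"
  by (simp add: vmodule_def is_vcat_def)

lemma vmodule_yoneda_left:
  assumes "vmodule X Y \<phi>" and "x \<in> pts X" and "y \<in> pts Y"
  shows "(SUP x'\<in>pts X. str X (x, x') * \<phi> (x', y)) = \<phi> (x, y)"
proof (rule antisym)
  show "(SUP x'\<in>pts X. str X (x, x') * \<phi> (x', y)) \<le> \<phi> (x, y)"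
    by (intro SUP_least vmodule_left[OF assms(1)] assms(2,3))
  show "\<phi> (x, y) \<le> (SUP x'\<in>pts X. str X (x, x') * \<phi> (x', y))"
    by (intro SUP_upper2[OF assms(2)] le_mult_left vcat_refl assms vmodule_vcat(1)[OF assms(1)])
qed

lemma vmodule_yoneda_right:
  assumes "vmodule X Y \<phi>" and "x \<in> pts X" and "y \<in> pts Y"
  shows "(SUP y'\<in>pts Y. \<phi> (x, y') * str Y (y', y)) = \<phi> (x, y)"
proof (rule antisym)
  show "(SUP y'\<in>pts Y. \<phi> (x, y') * str Y (y', y)) \<le> \<phi> (x, y)"
    by (intro SUP_least vmodule_right[OF assms(1)] assms(2,3))
  show "\<phi> (x, y) \<le> (SUP y'\<in>pts Y. \<phi> (x, y') * str Y (y', y))"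
    by (intro SUP_upper2[OF assms(3)] le_mult_right vcat_refl assms vmodule_vcat(2)[OF assms(1)])
qed

lemma mcomp_str_right: "vmodule X Y \<phi> \<Longrightarrow> mcomp X X Y \<phi> (str X) = \<phi>"
  by (rule extensional_eqI[OF mcomp_ext vmodule_ext])
    (simp_all add: mcomp_apply vmodule_yoneda_left)

lemma mcomp_str_left: "vmodule X Y \<phi> \<Longrightarrow> mcomp X Y Y (str Y) \<phi> = \<phi>"
  by (rule extensional_eqI[OF mcomp_ext vmodule_ext])
    (simp_all add: mcomp_apply vmodule_yoneda_right)

lemma vmodule_mcomp:
  assumes \<phi>: "vmodule X Y \<phi>" and \<psi>: "vmodule Y Z \<psi>"
  shows "vmodule X Z (mcomp X Y Z \<psi> \<phi>)"
  unfolding vmodule_def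
proof (intro conjI ballI)
  show "is_vcat X" and "is_vcat Z"
    using \<phi> \<psi> by (simp_all add: vmodule_vcat)
  show "mcomp X Y Z \<psi> \<phi> \<in> pts X \<times> pts Z \<rightarrow>\<^sub>E UNIV"
    by (rule mcomp_ext)
next
  fix x' x z assume p: "x' \<in> pts X" "x \<in> pts X" "z \<in> pts Z"
  have "str X (x', x) * (SUP y\<in>pts Y. \<phi> (x, y) * \<psi> (y, z))
      = (SUP y\<in>pts Y. (str X (x', x) * \<phi> (x, y)) * \<psi> (y, z))"
    by (simp add: mult_SUP mult.assoc)
  also have "\<dots> \<le> (SUP y\<in>pts Y. \<phi> (x', y) * \<psi> (y, z))"
    by (intro SUP_subset_mono quantale_mult_mono order_refl vmodule_left[OF \<phi>] p)
  finally show "str X (x', x) * mcomp X Y Z \<psi> \<phi> (x, z) \<le> mcomp X Y Z \<psi> \<phi> (x', z)"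
    using p by (simp add: mcomp_apply)
next
  fix x z z' assume p: "x \<in> pts X" "z \<in> pts Z" "z' \<in> pts Z"
  have "(SUP y\<in>pts Y. \<phi> (x, y) * \<psi> (y, z)) * str Z (z, z')
      = (SUP y\<in>pts Y. \<phi> (x, y) * (\<psi> (y, z) * str Z (z, z')))"
    by (simp add: SUP_mult mult.assoc)
  also have "\<dots> \<le> (SUP y\<in>pts Y. \<phi> (x, y) * \<psi> (y, z'))"
    by (intro SUP_subset_mono quantale_mult_mono order_refl vmodule_right[OF \<psi>] p)
  finally show "mcomp X Y Z \<psi> \<phi> (x, z) * str Z (z, z') \<le> mcomp X Y Z \<psi> \<phi> (x, z')"
    using p by (simp add: mcomp_apply)
qed

lemma mcomp_assoc:
  "mcomp W Y Z \<chi> (mcomp W X Y \<psi> \<phi>) = mcomp W X Z (mcomp X Y Z \<chi> \<psi>) \<phi>"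
proof (rule extensional_eqI[OF mcomp_ext mcomp_ext])
  fix w z assume p: "w \<in> pts W" "z \<in> pts Z"
  have "mcomp W Y Z \<chi> (mcomp W X Y \<psi> \<phi>) (w, z)
      = (SUP y\<in>pts Y. SUP x\<in>pts X. \<phi> (w, x) * (\<psi> (x, y) * \<chi> (y, z)))"
    using p by (simp add: mcomp_apply SUP_mult mult.assoc cong: SUP_cong_simp)
  also have "\<dots> = (SUP x\<in>pts X. SUP y\<in>pts Y. \<phi> (w, x) * (\<psi> (x, y) * \<chi> (y, z)))"
    by (rule SUP_commute)
  also have "\<dots> = mcomp W X Z (mcomp X Y Z \<chi> \<psi>) \<phi> (w, z)"
    using p by (simp add: mcomp_apply mult_SUP cong: SUP_cong_simp)
  finally show "mcomp W Y Z \<chi> (mcomp W X Y \<psi> \<phi>) (w, z)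
      = mcomp W X Z (mcomp X Y Z \<chi> \<psi>) \<phi> (w, z)" .
qed

lemma category_VMod: "category (VMod :: (('a, 'v::comm_unital_quantale) vcat, _) cat_data)"
  by unfold_locales
    (auto simp: VMod_def vmodule_str vmodule_mcomp mcomp_str_right mcomp_str_left mcomp_assoc)

section \<open>The Hausdorff category and the canonical algebra\<close>

lemma pts_Hcat [simp]: "pts (Hcat X) = Pow (pts X)"
  by (simp add: Hcat_def)

lemma str_Hcat:
  "A \<subseteq> pts X \<Longrightarrow> B \<subseteq> pts X \<Longrightarrow> str (Hcat X) (A, B) = (INF x\<in>A. SUP y\<in>B. str X (x, y))"
  by (simp add: Hcat_def)

lemma str_Hcat_singleton:
  "A \<subseteq> pts X \<Longrightarrow> y \<in> pts X \<Longrightarrow> str (Hcat X) (A, {y}) = (INF x\<in>A. str X (x, y))"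
  by (simp add: str_Hcat)

lemma is_vcat_Hcat:
  assumes "is_vcat X"
  shows "is_vcat (Hcat X)"
  unfolding is_vcat_def
proof (intro conjI ballI)
  show "str (Hcat X) \<in> pts (Hcat X) \<times> pts (Hcat X) \<rightarrow>\<^sub>E UNIV"
    by (simp add: Hcat_def PiE_iff)
next
  fix A assume "A \<in> pts (Hcat X)"
  then have A: "A \<subseteq> pts X" by simp
  have "1 \<le> (INF x\<in>A. SUP y\<in>A. str X (x, y))"
  proof (rule INF_greatest)
    fix x assume "x \<in> A"
    then show "1 \<le> (SUP y\<in>A. str X (x, y))"
      using A by (intro SUP_upper2[of x] vcat_refl assms) auto
  qed
  then show "1 \<le> str (Hcat X) (A, A)"
    using A by (simp add: str_Hcat)
next
  fix A B C assume "A \<in> pts (Hcat X)" "B \<in> pts (Hcat X)" "C \<in> pts (Hcat X)"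
  then have sub: "A \<subseteq> pts X" "B \<subseteq> pts X" "C \<subseteq> pts X" by simp_all
  have "(INF x\<in>A. SUP y\<in>B. str X (x, y)) * (INF y\<in>B. SUP z\<in>C. str X (y, z))
      \<le> (INF x\<in>A. SUP z\<in>C. str X (x, z))"
    by (rule INF_SUP_mult_le) (use sub in \<open>blast intro: vcat_trans[OF assms]\<close>)
  then show "str (Hcat X) (A, B) * str (Hcat X) (B, C) \<le> str (Hcat X) (A, C)"
    using sub by (simp add: str_Hcat)
qed

text \<open>The canonical structure \<open>\<alpha>(A, y) = h\<^sub>X(A, {y})\<close>, restricted so as to be extensional.\<close>

definition canonical_alg ::
  "('a, 'v::comm_unital_quantale) vcat \<Rightarrow> ('a set \<times> 'a \<Rightarrow> 'v)" where
  "canonical_alg X = restrict (\<lambda>(A, y). str (Hcat X) (A, {y})) (Pow (pts X) \<times> pts X)"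

lemma canonical_alg_apply:
  "A \<subseteq> pts X \<Longrightarrow> y \<in> pts X \<Longrightarrow> canonical_alg X (A, y) = str (Hcat X) (A, {y})"
  by (simp add: canonical_alg_def)

lemma vmodule_canonical_alg:
  assumes X: "is_vcat X"
  shows "vmodule (Hcat X) X (canonical_alg X)"
  unfolding vmodule_def
proof (intro conjI ballI)
  show "is_vcat X" "is_vcat (Hcat X)"
    using X by (simp_all add: is_vcat_Hcat)
  show "canonical_alg X \<in> pts (Hcat X) \<times> pts X \<rightarrow>\<^sub>E UNIV"
    by (simp add: canonical_alg_def PiE_iff)
next
  fix A' A y assume "A' \<in> pts (Hcat X)" "A \<in> pts (Hcat X)" "y \<in> pts X"
  then show "str (Hcat X) (A', A) * canonical_alg X (A, y) \<le> canonical_alg X (A', y)"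
    using vcat_trans[OF is_vcat_Hcat[OF X], of A' A "{y}"] by (simp add: canonical_alg_apply)
next
  fix A y y' assume "A \<in> pts (Hcat X)" "y \<in> pts X" "y' \<in> pts X"
  then show "canonical_alg X (A, y) * str X (y, y') \<le> canonical_alg X (A, y')"
    using vcat_trans[OF is_vcat_Hcat[OF X], of A "{y}" "{y'}"]
    by (simp add: canonical_alg_apply str_Hcat)
qed

lemma mcomp_unitH_apply:
  assumes "vmodule (Hcat X) Y \<alpha>" and "x \<in> pts X" and "y \<in> pts Y"
  shows "mcomp X (Hcat X) Y \<alpha> (unitH X) (x, y) = \<alpha> ({x}, y)"
  using vmodule_yoneda_left[OF assms(1), of "{x}" y] assms(2,3)
  by (simp add: mcomp_apply unitH_def cong: SUP_cong_simp)

lemma mcomp_multH_apply: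
  assumes "vmodule (Hcat X) Y \<alpha>" and "\<A> \<subseteq> Pow (pts X)" and "y \<in> pts Y"
  shows "mcomp (Hcat (Hcat X)) (Hcat X) Y \<alpha> (multH X) (\<A>, y) = \<alpha> (\<Union>\<A>, y)"
proof -
  have "\<Union>\<A> \<subseteq> pts X"
    using assms(2) by blast
  then show ?thesis
    using vmodule_yoneda_left[OF assms(1), of "\<Union>\<A>" y] assms(2,3)
    by (simp add: mcomp_apply multH_def cong: SUP_cong_simp)
qed

lemma strict_alg_canonical_alg:
  assumes X: "is_vcat X"
  shows "strict_alg X (canonical_alg X)"
proof -
  let ?\<alpha> = "canonical_alg X"
  note mod = vmodule_canonical_alg[OF X]
  have unit: "mcomp X (Hcat X) X ?\<alpha> (unitH X) = str X"
    by (rule extensional_eqI[OF mcomp_ext vmodule_ext[OF vmodule_str[OF X]]])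
      (simp add: mcomp_unitH_apply[OF mod] canonical_alg_apply str_Hcat)
  have mult: "mcomp (Hcat (Hcat X)) (Hcat X) X ?\<alpha> (multH X)
      = mcomp (Hcat (Hcat X)) (Hcat X) X ?\<alpha> (Hmod (Hcat X) X ?\<alpha>)"
  proof (rule extensional_eqI[OF mcomp_ext mcomp_ext])
    fix \<A> y assume "\<A> \<in> pts (Hcat (Hcat X))" and y: "y \<in> pts X"
    then have \<A>: "\<A> \<subseteq> Pow (pts X)" by simp
    have H: "Hmod (Hcat X) X ?\<alpha> (\<A>, B) = (INF A\<in>\<A>. SUP z\<in>B. ?\<alpha> (A, z))" if "B \<subseteq> pts X" for B
      using that \<A> by (simp add: Hmod_def)
    have lhs: "?\<alpha> (\<Union>\<A>, y) = (INF A\<in>\<A>. ?\<alpha> (A, y))"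
    proof -
      have "\<Union>\<A> \<subseteq> pts X" using \<A> by blast
      then have "?\<alpha> (\<Union>\<A>, y) = (INF x\<in>\<Union>\<A>. str X (x, y))"
        using y by (simp add: canonical_alg_apply str_Hcat_singleton)
      also have "\<dots> = (INF A\<in>\<A>. INF x\<in>A. str X (x, y))"
        by (intro antisym INF_greatest) (auto intro: INF_lower2)
      also have "\<dots> = (INF A\<in>\<A>. ?\<alpha> (A, y))"
        using \<A> y by (intro INF_cong refl) (auto simp: canonical_alg_apply str_Hcat_singleton)
      finally show ?thesis .
    qed
    have "(SUP B\<in>Pow (pts X). Hmod (Hcat X) X ?\<alpha> (\<A>, B) * ?\<alpha> (B, y)) = (INF A\<in>\<A>. ?\<alpha> (A, y))"
    proof (rule antisym)
      show "(SUP B\<in>Pow (pts X). Hmod (Hcat X) X ?\<alpha> (\<A>, B) * ?\<alpha> (B, y)) \<le> (INF A\<in>\<A>. ?\<alpha> (A, y))"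
      proof (rule SUP_least)
        fix B assume "B \<in> Pow (pts X)"
        then have B: "B \<subseteq> pts X" by simp
        have "(INF A\<in>\<A>. SUP z\<in>B. ?\<alpha> (A, z)) * (INF z\<in>B. SUP w\<in>{y}. str X (z, w))
            \<le> (INF A\<in>\<A>. SUP w\<in>{y}. ?\<alpha> (A, w))"
          by (rule INF_SUP_mult_le) (use \<A> B y in \<open>auto intro!: vmodule_right[OF mod]\<close>)
        then show "Hmod (Hcat X) X ?\<alpha> (\<A>, B) * ?\<alpha> (B, y) \<le> (INF A\<in>\<A>. ?\<alpha> (A, y))"
          using B y by (simp add: H canonical_alg_apply str_Hcat_singleton)
      qed
      have "1 \<le> ?\<alpha> ({y}, y)"
        using y vcat_refl[OF X y] by (simp add: canonical_alg_apply str_Hcat)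
      then have "(INF A\<in>\<A>. ?\<alpha> (A, y)) \<le> Hmod (Hcat X) X ?\<alpha> (\<A>, {y}) * ?\<alpha> ({y}, y)"
        using y H[of "{y}"] le_mult_right by simp
      then show "(INF A\<in>\<A>. ?\<alpha> (A, y))
          \<le> (SUP B\<in>Pow (pts X). Hmod (Hcat X) X ?\<alpha> (\<A>, B) * ?\<alpha> (B, y))"
        using y by (intro SUP_upper2[of "{y}"]) auto
    qed
    then show "mcomp (Hcat (Hcat X)) (Hcat X) X ?\<alpha> (multH X) (\<A>, y)
        = mcomp (Hcat (Hcat X)) (Hcat X) X ?\<alpha> (Hmod (Hcat X) X ?\<alpha>) (\<A>, y)"
      unfolding mcomp_multH_apply[OF mod \<A> y] lhs using \<A> y by (simp add: mcomp_apply)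
  qed
  show ?thesis
    unfolding strict_alg_def using X mod unit mult by blast
qed

text \<open>Only the unit law of the algebra is used.\<close>

lemma unital_structure_eq_canonical_alg:
  assumes mod: "vmodule (Hcat X) X \<alpha>" and unit: "mcomp X (Hcat X) X \<alpha> (unitH X) = str X"
  shows "\<alpha> = canonical_alg X"
proof -
  have X: "is_vcat X"
    using mod by (rule vmodule_vcat)
  have \<alpha>: "\<alpha> ({x}, y) = str X (x, y)" if "x \<in> pts X" "y \<in> pts X" for x y
    using mcomp_unitH_apply[OF mod that] unit by simp
  show ?thesis
  proof (rule extensional_eqI[OF vmodule_ext[OF mod] vmodule_ext[OF vmodule_canonical_alg[OF X]]])
    fix A y assume "A \<in> pts (Hcat X)" and y: "y \<in> pts X"
    then have A: "A \<subseteq> pts X" by simp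
    show "\<alpha> (A, y) = canonical_alg X (A, y)"
    proof (rule antisym)
      have "\<alpha> (A, y) \<le> (INF x\<in>A. str X (x, y))"
      proof (rule INF_greatest)
        fix x assume x: "x \<in> A"
        then have xX: "x \<in> pts X" using A by blast
        have "1 \<le> str X (x, x)"
          by (rule vcat_refl[OF X xX])
        also have "\<dots> \<le> str (Hcat X) ({x}, A)"
          using x xX A by (auto simp: str_Hcat intro!: SUP_upper2[of x])
        finally have "\<alpha> (A, y) \<le> str (Hcat X) ({x}, A) * \<alpha> (A, y)"
          by (rule le_mult_left)
        also have "\<dots> \<le> \<alpha> ({x}, y)"
          using A xX y by (intro vmodule_left[OF mod]) auto
        finally show "\<alpha> (A, y) \<le> str X (x, y)"
          by (simp add: \<alpha> xX y)
      qed
      then show "\<alpha> (A, y) \<le> canonical_alg X (A, y)"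
        using A y by (simp add: canonical_alg_apply str_Hcat_singleton)
      have "1 \<le> \<alpha> ({y}, y)"
        using vcat_refl[OF X y] by (simp add: \<alpha> y)
      then have "str (Hcat X) (A, {y}) \<le> str (Hcat X) (A, {y}) * \<alpha> ({y}, y)"
        by (rule le_mult_right)
      also have "\<dots> \<le> \<alpha> (A, y)"
        using A y by (intro vmodule_left[OF mod]) auto
      finally show "canonical_alg X (A, y) \<le> \<alpha> (A, y)"
        using A y by (simp add: canonical_alg_apply)
    qed
  qed
qed

lemma strict_alg_iff: "strict_alg X \<alpha> \<longleftrightarrow> is_vcat X \<and> \<alpha> = canonical_alg X"
  using strict_alg_canonical_alg unital_structure_eq_canonical_alg
  unfolding strict_alg_def by blast

section \<open>Lax homomorphisms and the isomorphism of categories\<close>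

lemma lax_hom_canonical_alg:
  assumes \<phi>: "vmodule X Y \<phi>"
  shows "lax_hom X (canonical_alg X) Y (canonical_alg Y) \<phi>"
  unfolding lax_hom_def
proof (intro conjI \<phi> le_funI)
  let ?l = "mcomp (Hcat X) X Y \<phi> (canonical_alg X)"
  let ?r = "mcomp (Hcat X) (Hcat Y) Y (canonical_alg Y) (Hmod X Y \<phi>)"
  fix p
  show "?l p \<le> ?r p"
  proof (cases "p \<in> Pow (pts X) \<times> pts Y")
    case True
    then obtain A y where p: "p = (A, y)" and A: "A \<subseteq> pts X" and y: "y \<in> pts Y" by auto
    have H: "Hmod X Y \<phi> (A, {y}) = (INF x\<in>A. \<phi> (x, y))"
      using A y by (simp add: Hmod_def)
    have "?l p = (SUP x\<in>pts X. canonical_alg X (A, x) * \<phi> (x, y))"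
      using A y by (simp add: p mcomp_apply)
    also have "\<dots> \<le> Hmod X Y \<phi> (A, {y})"
    proof (rule SUP_least)
      fix x assume x: "x \<in> pts X"
      have "(INF x'\<in>A. SUP x''\<in>{x}. str X (x', x'')) * (INF x''\<in>{x}. SUP y'\<in>{y}. \<phi> (x'', y'))
          \<le> (INF x'\<in>A. SUP y'\<in>{y}. \<phi> (x', y'))"
        by (rule INF_SUP_mult_le) (use A x y in \<open>auto intro!: vmodule_left[OF \<phi>]\<close>)
      then show "canonical_alg X (A, x) * \<phi> (x, y) \<le> Hmod X Y \<phi> (A, {y})"
        using A x by (simp add: H canonical_alg_apply str_Hcat_singleton)
    qed
    also have "\<dots> \<le> Hmod X Y \<phi> (A, {y}) * canonical_alg Y ({y}, y)"
      using vcat_refl[OF vmodule_vcat(2)[OF \<phi>] y] y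
      by (intro le_mult_right) (simp add: canonical_alg_apply str_Hcat)
    also have "\<dots> \<le> (SUP B\<in>Pow (pts Y). Hmod X Y \<phi> (A, B) * canonical_alg Y (B, y))"
      using y by (intro SUP_upper) simp
    also have "\<dots> = ?r p"
      using A y by (simp add: p mcomp_apply)
    finally show ?thesis .
  next
    case False
    \<comment> \<open>Off the carriers both sides are the same default value.\<close>
    then show ?thesis by (simp add: mcomp_def)
  qed
qed

lemma lax_hom_iff_vmodule:
  assumes "strict_alg X \<alpha>" and "strict_alg Y \<beta>"
  shows "lax_hom X \<alpha> Y \<beta> \<phi> \<longleftrightarrow> vmodule X Y \<phi>"
  using assms lax_hom_canonical_alg by (auto simp: strict_alg_iff lax_hom_def)

lemma category_StrictAlg:
  "category (StrictAlg ::
    (('a, 'v::comm_unital_quantale) vcat \<times> ('a set \<times> 'a \<Rightarrow> 'v), _) cat_data)"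
proof -
  have vcat: "is_vcat X" if "strict_alg X \<alpha>" for X :: "('a, 'v) vcat" and \<alpha>
    using that by (simp add: strict_alg_iff)
  show ?thesis
    by unfold_locales
      (auto simp: StrictAlg_def lax_hom_iff_vmodule vcat vmodule_str vmodule_mcomp
        mcomp_str_right mcomp_str_left mcomp_assoc)
qed

theorem corollary2:
  shows "category_isomorphism
           (StrictAlg :: (('a, 'v::comm_unital_quantale) vcat \<times> ('a set \<times> 'a \<Rightarrow> 'v), _) cat_data)
           VMod fst (\<lambda>_ _ \<phi>. \<phi>)
       \<and> (\<forall>X :: ('b, 'v) vcat. is_vcat X \<longrightarrow> (\<exists>!\<alpha>. strict_alg X \<alpha>))
       \<and> (\<forall>(X :: ('b, 'v) vcat) (Y :: ('c, 'v) vcat) \<alpha> \<beta> \<phi>.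
            strict_alg X \<alpha> \<longrightarrow> strict_alg Y \<beta> \<longrightarrow> vmodule X Y \<phi> \<longrightarrow> lax_hom X \<alpha> Y \<beta> \<phi>)"
proof (intro conjI allI impI)
  let ?S = "StrictAlg :: (('a, 'v) vcat \<times> ('a set \<times> 'a \<Rightarrow> 'v), _) cat_data"
  show "category_isomorphism ?S VMod fst (\<lambda>_ _ \<phi>. \<phi>)"
  proof (intro category_isomorphism.intro category_isomorphism_axioms.intro
      category_StrictAlg category_VMod)
    show "bij_betw fst (Obj ?S) (Obj VMod)"
      by (auto simp: bij_betw_def inj_on_def StrictAlg_def VMod_def strict_alg_iff image_iff)
  next
    fix x y assume "x \<in> Obj ?S" "y \<in> Obj ?S"
    then have "Hom ?S x y = Hom VMod (fst x) (fst y)"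
      by (auto simp: StrictAlg_def VMod_def lax_hom_iff_vmodule)
    then show "bij_betw (\<lambda>\<phi>. \<phi>) (Hom ?S x y) (Hom VMod (fst x) (fst y))"
      by (simp add: bij_betw_def inj_on_def)
  qed (auto simp: StrictAlg_def VMod_def)
next
  fix X :: "('b, 'v) vcat" assume "is_vcat X"
  then show "\<exists>!\<alpha>. strict_alg X \<alpha>"
    by (simp add: strict_alg_iff)
next
  fix X :: "('b, 'v) vcat" and Y :: "('c, 'v) vcat" and \<alpha> \<beta> \<phi>
  assume "strict_alg X \<alpha>" "strict_alg Y \<beta>" "vmodule X Y \<phi>"
  then show "lax_hom X \<alpha> Y \<beta> \<phi>"
    by (simp add: lax_hom_iff_vmodule)
qed

end
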